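(* Let $n,m,p\ge 1$ be integers and let $\Phi:\mathbb{R}^n\to\mathbb{R}^m$, $f:\mathbb{R}^m\to\mathbb{R}$, $c:\mathbb{R}^m\to\mathbb{R}^p$ be functions such that $\Phi$ is continuous, $f$ is differentiable, and the feasible set $F:=\{x\in\mathbb{R}^n: c(\Phi(x))\le 0\}$ is nonempty, compact and ample, i.e. $F\subseteq\mathrm{cl}(\mathrm{int}(F))$. Let $(x^k_\sharp)_{k\in\mathbb{N}}$ be the sequence of incumbent solutions generated by the hybrid algorithm described in the context, applied to the problem of maximizing $f(\Phi(x))$ over $x\in\mathbb{R}^n$ subject to $c(\Phi(x))\le 0$. Then $(x^k_\sharp)_{k\in\mathbb{N}}$ admits at least one accumulation point, and every accumulation point of $(x^k_\sharp)_{k\in\mathbb{N}}$ is a local solution of this problem.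
   Context: Notation. $\|\cdot\|$ is a fixed norm on $\mathbb{R}^n$; $\mathcal{B}^n_r(x)$ is the closed ball of radius $r$ centred at $x$, $\mathcal{B}^n_r:=\mathcal{B}^n_r(0)$; $\mathrm{dist}(x',\mathcal{H}):=\inf_{h\in\mathcal{H}}\|x'-h\|$. A local solution is a point $x^*\in F$ for which there is a neighbourhood $U$ of $x^*$ with $f(\Phi(x))\le f(\Phi(x^* ))$ for all $x\in F\cap U$. For a set $\mathcal{T}\subseteq\mathbb{R}^n$, "select $t\in\arg\max f(\Phi(\mathcal{T}\cap F))$" means select $t\in\mathcal{T}\cap F$ maximizing $f\circ\Phi$ over $\mathcal{T}\cap F$. Operators. - An attack operator is a set-valued function $\mathrm{attack}:\mathbb{R}^n\times\mathbb{R}_+\to 2^{\mathbb{R}^n}$ such that for all $(x,r)$, every $d\in\mathrm{attack}(x,r)$ is a feasible attack at $x$ of radius $r$, i.e. $d\in\mathcal{B}^n_r$ and $c(\Phi(x+d))\le 0$ (the set $\mathrm{attack}(x,r)$ may be empty). - A covering operator is the set-valued function $\mathrm{covering}:\mathbb{R}^n\times 2^{\mathbb{R}^n}\to 2^{\mathbb{R}^n}$ with $\mathrm{covering}(x,\mathcal{H}):=\arg\max_{x'\in\mathcal{B}^n_1(x)}\mathrm{dist}(x',\mathcal{H})$ (the set of all maximizers) for all $x$ and all $\mathcal{H}\neq\emptyset$. - A search operator is a set-valued function $\mathrm{search}:\mathbb{R}^n\times 2^{\mathbb{R}^n}\to 2^{\mathbb{R}^n}$ such that $\mathrm{search}(x,\mathcal{H})$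 is empty or finite for all $(x,\mathcal{H})$. - A poll operator is a set-valued function $\mathrm{poll}$ mapping $(x,r,\mathcal{H})$, with $x\in\mathbb{R}^n$, $r>0$, $\mathcal{H}\subseteq\mathbb{R}^n$, to a subset of $\mathbb{R}^n$ such that $\{t-x: t\in\mathrm{poll}(x,r,\mathcal{H})\}\subseteq\mathcal{B}^n_r$ and this set positively spans $\mathbb{R}^n$ (every vector of $\mathbb{R}^n$ is a nonnegative linear combination of its elements). Function $\mathrm{IterAttack}(x,r,\mathcal{H},\tau)$: set $\mathcal{T}_A:=\{x+d: d\in\mathrm{attack}(x,r)\}$. If $\mathcal{T}_A\cap F\neq\emptyset$, select $t_A\in\arg\max f(\Phi(\mathcal{T}_A\cap F))$, else set $t_A:=x$. If $f(\Phi(t_A))>f(\Phi(x))$, return $(t_A,\tau r,\mathcal{H}\cup\mathcal{T}_A)$; otherwise return $(x,\tau^{-1}r,\mathcal{H}\cup\mathcal{T}_A)$. Function $\mathrm{IterCDSM}(x,r,\mathcal{H},\tau)$, executing the following steps in order until one returns: 1. (Covering) Set $\mathcal{T}_C:=\mathrm{covering}(x,\mathcal{H})$. If $\mathcal{T}_C\cap F\neq\emptyset$, select $t_C\in\arg\max f(\Phi(\mathcal{T}_C\cap F))$, else $t_C:=x$. If $f(\Phi(t_C))>f(\Phi(x))$, return $(t_C,r,\mathcal{H}\cup\mathcal{T}_C)$. 2. (Search) Set $\mathcal{T}_S:=\mathrm{search}(x,\mathcal{H})$. If $\mathcal{T}_S\cap F\neq\emptyset$, select $t_S\in\arg\max f(\Phi(\mathcal{T}_S\cap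 F))$, else $t_S:=x$. If $f(\Phi(t_S))>f(\Phi(x))$, return $(t_S,r,\mathcal{H}\cup\mathcal{T}_C\cup\mathcal{T}_S)$. 3. (Poll) Set $\mathcal{T}_P:=\mathrm{poll}(x,r,\mathcal{H})$. If $\mathcal{T}_P\cap F\neq\emptyset$, select $t_P\in\arg\max f(\Phi(\mathcal{T}_P\cap F))$, else $t_P:=x$. If $f(\Phi(t_P))>f(\Phi(x))$, return $(t_P,\tau r,\mathcal{H}\cup\mathcal{T}_C\cup\mathcal{T}_S\cup\mathcal{T}_P)$. 4. (Failure) Return $(x,\tau^{-1}r,\mathcal{H}\cup\mathcal{T}_C\cup\mathcal{T}_S\cup\mathcal{T}_P)$. Hybrid algorithm: choose an attack, a covering, a search and a poll operator; choose $\tau_{\mathrm{atck}}>1$ and $\tau_{\mathrm{cdsm}}>1$; choose $x^0\in F$, $r^0_{\mathrm{atck}}>0$, $r^0_{\mathrm{cdsm}}>0$; set $\mathcal{H}^0:=\{x^0\}$. For $k=0,1,2,\dots$ set $$(x^k_\sharp,\,r^{k+1}_{\mathrm{atck}},\,\mathcal{H}^k_\sharp):=\mathrm{IterAttack}(x^k,r^k_{\mathrm{atck}},\mathcal{H}^k,\tau_{\mathrm{atck}}),$$ $$(x^{k+1},\,r^{k+1}_{\mathrm{cdsm}},\,\mathcal{H}^{k+1}):=\mathrm{IterCDSM}(x^k_\sharp,r^k_{\mathrm{cdsm}},\mathcal{H}^k_\sharp,\tau_{\mathrm{cdsm}}).$$ The statement concerns any sequence $(x^k_\sharp)_{k\in\mathbb{N}}$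 generated in this way, for any choices of the operators, parameters and selections. *)

theory Defs
  imports "HOL-Analysis.Analysis"
begin

text \<open>
  The norm is an arbitrary function \<open>N\<close> satisfying the norm axioms, rather than the Euclidean
  \<^const>\<open>norm\<close> of the type class. Topological notions (continuity, compactness, convergence)
  are those of the type; on a finite-dimensional space they do not depend on \<open>N\<close>.
\<close>

definition is_norm :: "('a::real_vector \<Rightarrow> real) \<Rightarrow> bool" where
  "is_norm N \<longleftrightarrow>
     (\<forall>x. 0 \<le> N x) \<and> (\<forall>x. N x = 0 \<longleftrightarrow> x = 0) \<and>
     (\<forall>a x. N (a *\<^sub>R x) = \<bar>a\<bar> * N x) \<and> (\<forall>x y. N (x + y) \<le> N x + N y)"

definition norm_cball :: "('a::real_vector \<Rightarrow> real) \<Rightarrow> 'a \<Rightarrow> real \<Rightarrow> 'a set" where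
  "norm_cball N x r = {y. N (y - x) \<le> r}"

text \<open>Only meaningful for nonempty \<open>H\<close>.\<close>

definition norm_setdist :: "('a::real_vector \<Rightarrow> real) \<Rightarrow> 'a \<Rightarrow> 'a set \<Rightarrow> real" where
  "norm_setdist N x H = (INF h\<in>H. N (x - h))"

definition argmax_on :: "('a \<Rightarrow> real) \<Rightarrow> 'a set \<Rightarrow> 'a set" where
  "argmax_on g S = {t. is_arg_max g (\<lambda>s. s \<in> S) t}"

definition positively_spans :: "'a::real_vector set \<Rightarrow> bool" where
  "positively_spans D \<longleftrightarrow>
     (\<forall>v. \<exists>S u. finite S \<and> S \<subseteq> D \<and> (\<forall>d\<in>S. 0 \<le> u d) \<and> v = (\<Sum>d\<in>S. u d *\<^sub>R d))"

definition accumulation_point :: "(nat \<Rightarrow> 'a::topological_space) \<Rightarrow> 'a \<Rightarrow> bool" where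
  "accumulation_point X a \<longleftrightarrow> (\<exists>s. strict_mono (s :: nat \<Rightarrow> nat) \<and> (X \<circ> s) \<longlonglongrightarrow> a)"

definition local_solution :: "('a::topological_space \<Rightarrow> real) \<Rightarrow> 'a set \<Rightarrow> 'a \<Rightarrow> bool" where
  "local_solution g F a \<longleftrightarrow>
     a \<in> F \<and> (\<exists>U. open U \<and> a \<in> U \<and> (\<forall>x \<in> F \<inter> U. g x \<le> g a))"

text \<open>In the following, \<open>F\<close> is the feasible set and \<open>g\<close> the composite objective.\<close>

definition attack_operator ::
  "('a::real_vector \<Rightarrow> real) \<Rightarrow> 'a set \<Rightarrow> ('a \<Rightarrow> real \<Rightarrow> 'a set) \<Rightarrow> bool" where
  "attack_operator N F attack \<longleftrightarrow>
     (\<forall>x r. 0 \<le> r \<longrightarrow> (\<forall>d \<in> attack x r. d \<in> norm_cball N 0 r \<and> x + d \<in> F))"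

definition covering_operator ::
  "('a::real_vector \<Rightarrow> real) \<Rightarrow> ('a \<Rightarrow> 'a set \<Rightarrow> 'a set) \<Rightarrow> bool" where
  "covering_operator N covering \<longleftrightarrow>
     (\<forall>x H. H \<noteq> {} \<longrightarrow> covering x H = argmax_on (\<lambda>y. norm_setdist N y H) (norm_cball N x 1))"

definition search_operator :: "('a \<Rightarrow> 'a set \<Rightarrow> 'a set) \<Rightarrow> bool" where
  "search_operator search \<longleftrightarrow> (\<forall>x H. finite (search x H))"

definition poll_operator ::
  "('a::real_vector \<Rightarrow> real) \<Rightarrow> ('a \<Rightarrow> real \<Rightarrow> 'a set \<Rightarrow> 'a set) \<Rightarrow> bool" where
  "poll_operator N poll \<longleftrightarrow>
     (\<forall>x r H. 0 < r \<longrightarrow>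
        (\<lambda>t. t - x) ` poll x r H \<subseteq> norm_cball N 0 r \<and>
        positively_spans ((\<lambda>t. t - x) ` poll x r H))"

text \<open>
  \<open>selects g F x T t\<close> holds for every admissible choice of \<open>t\<close>; there is none if \<open>T \<inter> F\<close> is
  nonempty but \<open>g\<close> does not attain its maximum on it. An iteration is therefore a relation between
  its inputs and its output triple (new incumbent, new radius, new history).
\<close>

definition selects :: "('a \<Rightarrow> real) \<Rightarrow> 'a set \<Rightarrow> 'a \<Rightarrow> 'a set \<Rightarrow> 'a \<Rightarrow> bool" where
  "selects g F x T t \<longleftrightarrow> (if T \<inter> F \<noteq> {} then t \<in> argmax_on g (T \<inter> F) else t = x)"

inductive iter_attack ::
  "('a::real_vector \<Rightarrow> real) \<Rightarrow> 'a set \<Rightarrow> ('a \<Rightarrow> real \<Rightarrow> 'a set)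
   \<Rightarrow> 'a \<Rightarrow> real \<Rightarrow> 'a set \<Rightarrow> real \<Rightarrow> 'a \<times> real \<times> 'a set \<Rightarrow> bool"
  for g F attack x r H \<tau> where
  success:
    "\<lbrakk>T = (\<lambda>d. x + d) ` attack x r; selects g F x T t; g t > g x\<rbrakk>
     \<Longrightarrow> iter_attack g F attack x r H \<tau> (t, \<tau> * r, H \<union> T)"
| failure:
    "\<lbrakk>T = (\<lambda>d. x + d) ` attack x r; selects g F x T t; \<not> g t > g x\<rbrakk>
     \<Longrightarrow> iter_attack g F attack x r H \<tau> (x, inverse \<tau> * r, H \<union> T)"

inductive iter_cdsm ::
  "('a \<Rightarrow> real) \<Rightarrow> 'a set \<Rightarrow> ('a \<Rightarrow> 'a set \<Rightarrow> 'a set) \<Rightarrow> ('a \<Rightarrow> 'a set \<Rightarrow> 'a set)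
   \<Rightarrow> ('a \<Rightarrow> real \<Rightarrow> 'a set \<Rightarrow> 'a set)
   \<Rightarrow> 'a \<Rightarrow> real \<Rightarrow> 'a set \<Rightarrow> real \<Rightarrow> 'a \<times> real \<times> 'a set \<Rightarrow> bool"
  for g F covering search poll x r H \<tau> where
  covering_success:
    "\<lbrakk>TC = covering x H; selects g F x TC tC; g tC > g x\<rbrakk>
     \<Longrightarrow> iter_cdsm g F covering search poll x r H \<tau> (tC, r, H \<union> TC)"
| search_success:
    "\<lbrakk>TC = covering x H; selects g F x TC tC; \<not> g tC > g x;
      TS = search x H; selects g F x TS tS; g tS > g x\<rbrakk>
     \<Longrightarrow> iter_cdsm g F covering search poll x r H \<tau> (tS, r, H \<union> TC \<union> TS)"
| poll_success:
    "\<lbrakk>TC = covering x H; selects g F x TC tC; \<not> g tC > g x;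
      TS = search x H; selects g F x TS tS; \<not> g tS > g x;
      TP = poll x r H; selects g F x TP tP; g tP > g x\<rbrakk>
     \<Longrightarrow> iter_cdsm g F covering search poll x r H \<tau> (tP, \<tau> * r, H \<union> TC \<union> TS \<union> TP)"
| failure:
    "\<lbrakk>TC = covering x H; selects g F x TC tC; \<not> g tC > g x;
      TS = search x H; selects g F x TS tS; \<not> g tS > g x;
      TP = poll x r H; selects g F x TP tP; \<not> g tP > g x\<rbrakk>
     \<Longrightarrow> iter_cdsm g F covering search poll x r H \<tau> (x, inverse \<tau> * r, H \<union> TC \<union> TS \<union> TP)"

text \<open>
  The sequences \<open>xs\<close>, \<open>ra\<close>, \<open>rc\<close>, \<open>Hs\<close> are the incumbents, attack radii, CDSM radii and histories
  at the start of each iteration; \<open>x_sharp\<close>, \<open>H_sharp\<close> are those between the two steps.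
\<close>

definition hybrid_run ::
  "('a::real_vector \<Rightarrow> real) \<Rightarrow> 'a set \<Rightarrow> ('a \<Rightarrow> real \<Rightarrow> 'a set)
   \<Rightarrow> ('a \<Rightarrow> 'a set \<Rightarrow> 'a set) \<Rightarrow> ('a \<Rightarrow> 'a set \<Rightarrow> 'a set) \<Rightarrow> ('a \<Rightarrow> real \<Rightarrow> 'a set \<Rightarrow> 'a set)
   \<Rightarrow> real \<Rightarrow> real \<Rightarrow> (nat \<Rightarrow> 'a) \<Rightarrow> (nat \<Rightarrow> real) \<Rightarrow> (nat \<Rightarrow> real) \<Rightarrow> (nat \<Rightarrow> 'a set)
   \<Rightarrow> (nat \<Rightarrow> 'a) \<Rightarrow> (nat \<Rightarrow> 'a set) \<Rightarrow> bool" where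
  "hybrid_run g F attack covering search poll \<tau>a \<tau>c xs ra rc Hs x_sharp H_sharp \<longleftrightarrow>
     xs 0 \<in> F \<and> 0 < ra 0 \<and> 0 < rc 0 \<and> Hs 0 = {xs 0} \<and>
     (\<forall>k. iter_attack g F attack (xs k) (ra k) (Hs k) \<tau>a (x_sharp k, ra (Suc k), H_sharp k) \<and>
          iter_cdsm g F covering search poll (x_sharp k) (rc k) (H_sharp k) \<tau>c
            (xs (Suc k), rc (Suc k), Hs (Suc k)))"

end

theory Submission
  imports Defs
begin

text \<open>
  The incumbent dominates every feasible point of the history, so an accumulation point \<open>a\<close>
  dominates every feasible trial point ever generated. Covering points are chosen farthest from the
  history and then join it; since they stay bounded, two of them with incumbents near \<open>a\<close> are
  arbitrarily close, so the distance of the later one to the history is small, and hence so is the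
  distance of every point of the unit ball around the incumbent. The trial points are therefore
  dense near \<open>a\<close>; as \<open>F\<close> is ample, continuity extends the domination to all feasible points near
  \<open>a\<close>.
\<close>

section \<open>Arbitrary norms on a Euclidean space\<close>

lemma is_norm_minus_commute:
  assumes "is_norm N"
  shows "N (x - y) = N (y - x)"
proof -
  have "N ((-1) *\<^sub>R (y - x)) = \<bar>-1\<bar> * N (y - x)"
    using assms unfolding is_norm_def by blast
  then show ?thesis by simp
qed

lemma is_norm_triangle:
  assumes "is_norm N"
  shows "N (x - z) \<le> N (x - y) + N (y - z)"
proof -
  have "N ((x - y) + (y - z)) \<le> N (x - y) + N (y - z)"
    using assms unfolding is_norm_def by blast
  then show ?thesis by simp
qed

text \<open>Homogeneity and the triangle inequality make a norm convex, and a finite convex function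
  on a finite-dimensional space is continuous.\<close>

lemma is_norm_continuous_on:
  fixes N :: "'a::euclidean_space \<Rightarrow> real"
  assumes "is_norm N"
  shows "continuous_on S N"
proof -
  have "convex_on UNIV N"
  proof (rule convex_onI)
    fix t x y assume t: "0 < (t::real)" "t < 1"
    have "N ((1 - t) *\<^sub>R x + t *\<^sub>R y) \<le> N ((1 - t) *\<^sub>R x) + N (t *\<^sub>R y)"
      using assms unfolding is_norm_def by blast
    also have "\<dots> = \<bar>1 - t\<bar> * N x + \<bar>t\<bar> * N y"
      using assms unfolding is_norm_def by metis
    finally show "N ((1 - t) *\<^sub>R x + t *\<^sub>R y) \<le> (1 - t) * N x + t * N y"
      using t by simp
  qed simp
  then have "continuous_on UNIV N"
    by (rule convex_on_continuous[OF open_UNIV])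
  then show ?thesis
    using continuous_on_subset by blast
qed

text \<open>The constants are the minimum and maximum of \<open>N\<close> on the Euclidean unit
  sphere, which exist by compactness; homogeneity carries the bounds to all vectors. They translate
  between \<open>N\<close> and the topology of the type.\<close>

lemma is_norm_equivalent:
  fixes N :: "'a::euclidean_space \<Rightarrow> real"
  assumes "is_norm N"
  obtains A B where "0 < A" "0 < B" "\<And>x. A * norm x \<le> N x" "\<And>x. N x \<le> B * norm x"
proof -
  let ?S = "sphere (0::'a) 1"
  have ne: "?S \<noteq> {}" by simp
  have cont: "continuous_on ?S N" by (rule is_norm_continuous_on[OF assms])
  obtain u where u: "u \<in> ?S" "\<And>y. y \<in> ?S \<Longrightarrow> N u \<le> N y"
    using continuous_attains_inf[OF compact_sphere ne cont] by blast
  obtain v where v: "v \<in> ?S" "\<And>y. y \<in> ?S \<Longrightarrow> N y \<le> N v"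
    using continuous_attains_sup[OF compact_sphere ne cont] by blast
  have "u \<noteq> 0" using u(1) by auto
  then have pos: "0 < N u"
    using assms unfolding is_norm_def by (metis order_le_less)
  have scale: "N x = norm x * N (x /\<^sub>R norm x)" if "x \<noteq> 0" for x
  proof -
    have "N (norm x *\<^sub>R (x /\<^sub>R norm x)) = \<bar>norm x\<bar> * N (x /\<^sub>R norm x)"
      using assms unfolding is_norm_def by blast
    then show ?thesis using that by simp
  qed
  have zero: "N 0 = 0" using assms unfolding is_norm_def by blast
  have in_S: "x /\<^sub>R norm x \<in> ?S" if "x \<noteq> 0" for x :: 'a
    using that by simp
  show ?thesis
  proof
    show "0 < N u" by (fact pos)
    show "0 < N v" using pos u(2)[OF v(1)] by simp
    show "N u * norm x \<le> N x" for x
      using u(2)[OF in_S, of x] scale[of x] zero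
      by (cases "x = 0") (auto simp: mult.commute mult_left_mono)
    show "N x \<le> N v * norm x" for x
      using v(2)[OF in_S, of x] scale[of x] zero
      by (cases "x = 0") (auto simp: mult.commute mult_left_mono)
  qed
qed

lemma compact_norm_cball:
  fixes N :: "'a::euclidean_space \<Rightarrow> real"
  assumes "is_norm N"
  shows "compact (norm_cball N x r)"
proof -
  obtain A where A: "0 < A" "\<And>y. A * norm y \<le> N y"
    using is_norm_equivalent[OF assms] by metis
  have "norm_cball N x r \<subseteq> cball x (r / A)"
  proof
    fix y assume "y \<in> norm_cball N x r"
    then have "A * norm (y - x) \<le> r"
      using A(2)[of "y - x"] by (simp add: norm_cball_def)
    then show "y \<in> cball x (r / A)"
      using A(1) by (simp add: dist_norm norm_minus_commute field_simps)
  qed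
  then have "bounded (norm_cball N x r)"
    using bounded_cball bounded_subset by blast
  moreover have "continuous_on UNIV (\<lambda>y. N (y - x))"
    by (rule continuous_on_compose2[OF is_norm_continuous_on[OF assms, of UNIV]])
       (auto intro: continuous_intros)
  then have "closed (norm_cball N x r)"
    unfolding norm_cball_def by (intro closed_Collect_le continuous_on_const)
  ultimately show ?thesis by (simp add: compact_eq_bounded_closed)
qed

section \<open>Distance to a set in an arbitrary norm\<close>

lemma norm_setdist_bdd_below:
  assumes "is_norm N"
  shows "bdd_below ((\<lambda>h. N (x - h)) ` H)"
  using assms unfolding is_norm_def by (intro bdd_belowI2) blast

lemma norm_setdist_le:
  assumes "is_norm N" "h \<in> H"
  shows "norm_setdist N x H \<le> N (x - h)"
  unfolding norm_setdist_def
  by (rule cINF_lower[OF norm_setdist_bdd_below[OF assms(1)] assms(2)])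

lemma norm_setdist_less_iff:
  assumes "is_norm N" "H \<noteq> {}"
  shows "norm_setdist N x H < e \<longleftrightarrow> (\<exists>h\<in>H. N (x - h) < e)"
  unfolding norm_setdist_def
  by (rule cINF_less_iff[OF assms(2) norm_setdist_bdd_below[OF assms(1)]])

lemma norm_setdist_lipschitz:
  assumes "is_norm N" "H \<noteq> {}"
  shows "norm_setdist N x H \<le> N (x - y) + norm_setdist N y H"
proof -
  have "norm_setdist N x H - N (x - y) \<le> norm_setdist N y H"
    unfolding norm_setdist_def[of N y]
  proof (rule cINF_greatest[OF assms(2)])
    fix h assume "h \<in> H"
    then have "norm_setdist N x H \<le> N (x - h)"
      by (rule norm_setdist_le[OF assms(1)])
    also have "\<dots> \<le> N (x - y) + N (y - h)"
      by (rule is_norm_triangle[OF assms(1)])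
    finally show "norm_setdist N x H - N (x - y) \<le> N (y - h)" by simp
  qed
  then show ?thesis by simp
qed

lemma norm_setdist_continuous_on:
  fixes N :: "'a::euclidean_space \<Rightarrow> real"
  assumes "is_norm N" "H \<noteq> {}"
  shows "continuous_on S (\<lambda>y. norm_setdist N y H)"
proof -
  obtain B where B: "0 < B" "\<And>y. N y \<le> B * norm y"
    using is_norm_equivalent[OF assms(1)] by metis
  have "\<bar>norm_setdist N x H - norm_setdist N y H\<bar> \<le> B * dist x y" for x y
    using norm_setdist_lipschitz[OF assms, of x y] norm_setdist_lipschitz[OF assms, of y x]
      is_norm_minus_commute[OF assms(1), of x y] B(2)[of "x - y"]
    by (simp add: dist_norm)
  then have "B-lipschitz_on S (\<lambda>y. norm_setdist N y H)"
    using B(1) by (intro lipschitz_onI) (auto simp: dist_real_def)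
  then show ?thesis by (rule lipschitz_on_continuous_on)
qed

section \<open>Covering points and their density near an accumulation point\<close>

lemma covering_operatorD:
  assumes "covering_operator N covering" "H \<noteq> {}" "t \<in> covering x H"
  shows "t \<in> norm_cball N x 1"
    and "y \<in> norm_cball N x 1 \<Longrightarrow> norm_setdist N y H \<le> norm_setdist N t H"
proof -
  have "t \<in> argmax_on (\<lambda>y. norm_setdist N y H) (norm_cball N x 1)"
    using assms by (simp add: covering_operator_def)
  then show "t \<in> norm_cball N x 1"
    and "y \<in> norm_cball N x 1 \<Longrightarrow> norm_setdist N y H \<le> norm_setdist N t H"
    by (auto simp: argmax_on_def is_arg_max_def not_less)
qed

text \<open>The distance to \<open>H\<close> is continuous and the unit ball of \<open>N\<close> is
  compact, so a farthest point exists. Hence every iteration has a covering point to add to the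
  history.\<close>

lemma covering_nonempty:
  fixes N :: "'a::euclidean_space \<Rightarrow> real"
  assumes "is_norm N" "covering_operator N covering" "H \<noteq> {}"
  shows "covering x H \<noteq> {}"
proof -
  have "N 0 = 0" using assms(1) unfolding is_norm_def by blast
  then have "norm_cball N x 1 \<noteq> {}"
    by (auto simp: norm_cball_def intro: exI[of _ x])
  then obtain t where "t \<in> norm_cball N x 1"
      "\<forall>y\<in>norm_cball N x 1. norm_setdist N y H \<le> norm_setdist N t H"
    using continuous_attains_sup[OF compact_norm_cball[OF assms(1)] _
        norm_setdist_continuous_on[OF assms(1,3)]] by blast
  then have "t \<in> covering x H"
    using assms(2,3)
    by (auto simp: covering_operator_def argmax_on_def is_arg_max_def not_less)
  then show ?thesis by blast
qed

text \<open>Of a run, only the fact that covering points enter all later histories matters here. The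
  strict bound on \<open>N (y - a)\<close> leaves the slack that keeps \<open>y\<close> in the unit
  ball around every incumbent close enough to \<open>a\<close>.\<close>

lemma covering_dense:
  fixes N :: "'a::euclidean_space \<Rightarrow> real"
  assumes N: "is_norm N" and cov: "covering_operator N covering"
    and ne: "\<And>k. H k \<noteq> {}"
    and hist: "\<And>j k. j < k \<Longrightarrow> covering (X j) (H j) \<subseteq> H k"
    and acc: "accumulation_point X a"
    and y: "N (y - a) < 1" and e: "0 < e"
  obtains k h where "h \<in> H k" "N (y - h) < e"
proof -
  obtain s where s: "strict_mono s" "(X \<circ> s) \<longlonglongrightarrow> a"
    using acc unfolding accumulation_point_def by blast
  obtain A B where AB: "0 < A" "0 < B" "\<And>x. A * norm x \<le> N x" "\<And>x. N x \<le> B * norm x"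
    using is_norm_equivalent[OF N] by metis
  have "\<forall>k. \<exists>t. t \<in> covering (X k) (H k)"
    using covering_nonempty[OF N cov ne] by blast
  then obtain t where t: "\<And>k. t k \<in> covering (X k) (H k)" by metis
  note t_ball = covering_operatorD(1)[OF cov ne t]
  \<comment> \<open>Each covering point is within \<open>N\<close>-distance 1 of its incumbent, and
    the incumbents along \<open>s\<close> converge.\<close>
  have "bounded (range (t \<circ> s))"
  proof -
    have "bounded (range (X \<circ> s))"
      using s(2) by (rule convergent_imp_bounded)
    then obtain R where R: "\<And>i. norm (X (s i)) \<le> R"
      unfolding bounded_iff by auto
    have "norm (t (s i)) \<le> R + 1 / A" for i
    proof -
      have "A * norm (t (s i) - X (s i)) \<le> 1"
        using t_ball[of "s i"] AB(3)[of "t (s i) - X (s i)"] by (simp add: norm_cball_def)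
      then have "norm (t (s i) - X (s i)) \<le> 1 / A"
        using AB(1) by (simp add: field_simps)
      then show ?thesis
        using R[of i] norm_triangle_sub[of "t (s i)" "X (s i)"] by simp
    qed
    then show ?thesis unfolding bounded_iff by auto
  qed
  then obtain l r where r: "strict_mono (r :: nat \<Rightarrow> nat)" "(t \<circ> s \<circ> r) \<longlonglongrightarrow> l"
    using bounded_imp_convergent_subsequence by blast
  have "Cauchy (t \<circ> s \<circ> r)" using r(2) by (rule LIMSEQ_imp_Cauchy)
  \<comment> \<open>Division by \<open>B\<close> turns the Euclidean estimate into an
    \<open>N\<close>-distance below \<open>e\<close>.\<close>
  then obtain M where M: "\<And>m n. m \<ge> M \<Longrightarrow> n \<ge> M \<Longrightarrow> norm (t (s (r m)) - t (s (r n))) < e / B"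
    using e AB(2) unfolding Cauchy_iff by (auto dest!: spec[of _ "e / B"])
  \<comment> \<open>The slack \<open>1 - N (y - a)\<close>, in Euclidean units, is how far an
    incumbent may be from \<open>a\<close> with \<open>y\<close> still in its unit ball.\<close>
  have "0 < (1 - N (y - a)) / B" using y AB(2) by simp
  then obtain K where K: "\<And>i. i \<ge> K \<Longrightarrow> norm (X (s i) - a) < (1 - N (y - a)) / B"
    using s(2) unfolding LIMSEQ_iff by (metis comp_apply)
  \<comment> \<open>Consecutive indices \<open>i\<close> and \<open>Suc i\<close> give the earlier
    and the later of two close covering points; \<open>k\<close> is the iteration of the later
    one.\<close>
  define i where "i = max M K"
  define k where "k = s (r (Suc i))"
  have "K \<le> r (Suc i)"
    using seq_suble[OF r(1), of "Suc i"] by (simp add: i_def)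
  then have "norm (X k - a) < (1 - N (y - a)) / B"
    unfolding k_def by (rule K)
  then have "B * norm (a - X k) < 1 - N (y - a)"
    using AB(2) by (simp add: field_simps norm_minus_commute)
  then have "y \<in> norm_cball N (X k) 1"
    using is_norm_triangle[OF N, of y "X k" a] AB(4)[of "a - X k"] by (simp add: norm_cball_def)
  then have "norm_setdist N y (H k) \<le> norm_setdist N (t k) (H k)"
    by (rule covering_operatorD(2)[OF cov ne t])
  \<comment> \<open>Preparation for the next inequality: the earlier covering point already lies in
    \<open>H k\<close>, so it bounds the distance from \<open>t k\<close> to
    \<open>H k\<close>.\<close>
  also have "s (r i) < k"
    using s(1) r(1) by (simp add: k_def strict_mono_less)
  then have "t (s (r i)) \<in> H k" using hist t by blast
  then have "norm_setdist N (t k) (H k) \<le> N (t k - t (s (r i)))"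
    by (rule norm_setdist_le[OF N])
  also have "\<dots> \<le> B * norm (t k - t (s (r i)))" by (rule AB(4))
  also have "\<dots> < e"
    using M[of "Suc i" i] AB(2) by (simp add: i_def k_def field_simps)
  finally show ?thesis
    using norm_setdist_less_iff[OF N ne] that by blast
qed

section \<open>Domination of the history as an invariant of the algorithm\<close>

lemma selects_feasible: "selects g F x T t \<Longrightarrow> x \<in> F \<Longrightarrow> t \<in> F"
  by (auto simp: selects_def argmax_on_def is_arg_max_def split: if_splits)

lemma selects_ge: "selects g F x T t \<Longrightarrow> h \<in> T \<Longrightarrow> h \<in> F \<Longrightarrow> g h \<le> g t"
  by (force simp: selects_def argmax_on_def is_arg_max_def not_less split: if_splits)

text \<open>Feasibility of the incumbent is included so that one invariant passes through every
  selection.\<close>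

definition dominates :: "('a \<Rightarrow> real) \<Rightarrow> 'a set \<Rightarrow> 'a \<Rightarrow> 'a set \<Rightarrow> bool" where
  "dominates g F x H \<longleftrightarrow> x \<in> F \<and> (\<forall>h \<in> H \<inter> F. g h \<le> g x)"

text \<open>After a success, the new incumbent maximizes \<open>g\<close> over the feasible part of
  \<open>T\<close> and exceeds the old one, hence all of \<open>H\<close>. After a failure, even the
  best feasible point of \<open>T\<close> does not exceed \<open>x\<close>.\<close>

lemma selects_dominates:
  assumes "selects g F x T t" "dominates g F x H"
  shows "g x < g t \<Longrightarrow> dominates g F t (H \<union> T)"
    and "\<not> g x < g t \<Longrightarrow> dominates g F x (H \<union> T)"
  using selects_feasible[OF assms(1)] selects_ge[OF assms(1)] assms(2)
  unfolding dominates_def by force+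

lemma iter_attack_dominates:
  assumes "iter_attack g F attack x r H \<tau> (x', r', H')" "dominates g F x H"
  shows "dominates g F x' H' \<and> g x \<le> g x' \<and> H \<subseteq> H'"
  using assms(1)
proof (cases rule: iter_attack.cases)
  case (success T)
  then show ?thesis using selects_dominates(1)[OF _ assms(2)] by auto
next
  case (failure T t)
  then show ?thesis using selects_dominates(2)[OF _ assms(2)] by auto
qed

text \<open>The trial sets are absorbed one after another, with \<open>selects_dominates\<close>
  applied to each. The covering set joins the history in all four outcomes, whether or not it
  improves the incumbent.\<close>

lemma iter_cdsm_dominates:
  assumes "iter_cdsm g F covering search poll x r H \<tau> (x', r', H')" "dominates g F x H"
  shows "dominates g F x' H' \<and> g x \<le> g x' \<and> H \<union> covering x H \<subseteq> H'"
  using assms(1)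
proof (cases rule: iter_cdsm.cases)
  case (covering_success TC)
  then show ?thesis using selects_dominates(1)[OF _ assms(2)] by auto
next
  case (search_success TC tC TS)
  have d1: "dominates g F x (H \<union> TC)"
    using search_success selects_dominates(2)[OF _ assms(2)] by blast
  have "dominates g F x' (H \<union> TC \<union> TS)"
    using search_success selects_dominates(1)[OF _ d1] by blast
  then show ?thesis using search_success by auto
next
  case (poll_success TC tC TS tS TP)
  have d1: "dominates g F x (H \<union> TC)"
    using poll_success selects_dominates(2)[OF _ assms(2)] by blast
  have d2: "dominates g F x (H \<union> TC \<union> TS)"
    using poll_success selects_dominates(2)[OF _ d1] by blast
  have "dominates g F x' (H \<union> TC \<union> TS \<union> TP)"
    using poll_success selects_dominates(1)[OF _ d2] by blast
  then show ?thesis using poll_success by auto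
next
  case (failure TC tC TS tS TP tP)
  have d1: "dominates g F x (H \<union> TC)"
    using failure selects_dominates(2)[OF _ assms(2)] by blast
  have d2: "dominates g F x (H \<union> TC \<union> TS)"
    using failure selects_dominates(2)[OF _ d1] by blast
  have "dominates g F x (H \<union> TC \<union> TS \<union> TP)"
    using failure selects_dominates(2)[OF _ d2] by blast
  then show ?thesis using failure by auto
qed

text \<open>The invariants are taken between the two halves of an iteration, since the covering
  operator is called there, with arguments \<open>X j\<close> and \<open>H j\<close>.\<close>

lemma hybrid_run_invariants:
  assumes "hybrid_run g F attack covering search poll \<tau>a \<tau>c xs ra rc Hs X H"
  shows "dominates g F (X k) (H k)" "H k \<noteq> {}"
    and "j \<le> k \<Longrightarrow> g (X j) \<le> g (X k)"
    and "j < k \<Longrightarrow> covering (X j) (H j) \<subseteq> H k"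
proof -
  have att: "iter_attack g F attack (xs k) (ra k) (Hs k) \<tau>a (X k, ra (Suc k), H k)"
    and cdsm: "iter_cdsm g F covering search poll (X k) (rc k) (H k) \<tau>c
      (xs (Suc k), rc (Suc k), Hs (Suc k))" for k
    using assms unfolding hybrid_run_def by auto
  have start: "dominates g F (xs k) (Hs k) \<and> Hs k \<noteq> {}" for k
  proof (induction k)
    case 0
    then show ?case using assms by (auto simp: hybrid_run_def dominates_def)
  next
    case (Suc k)
    then show ?case
      using iter_attack_dominates[OF att, of k] iter_cdsm_dominates[OF cdsm, of k] by blast
  qed
  have dom: "dominates g F (X k) (H k)" "H k \<noteq> {}" for k
    using iter_attack_dominates[OF att, of k] start[of k] by blast+
  then show "dominates g F (X k) (H k)" "H k \<noteq> {}" by blast+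
  \<comment> \<open>Passing from \<open>X k\<close> to \<open>X (Suc k)\<close> means the CDSM half
    of iteration \<open>k\<close> followed by the attack half of iteration
    \<open>Suc k\<close>.\<close>
  have step: "g (X k) \<le> g (X (Suc k))" "H k \<union> covering (X k) (H k) \<subseteq> H (Suc k)" for k
    using iter_cdsm_dominates[OF cdsm dom(1), of k]
      iter_attack_dominates[OF att, of "Suc k"] start[of "Suc k"]
    by (auto intro: order_trans)
  show "j \<le> k \<Longrightarrow> g (X j) \<le> g (X k)"
    using lift_Suc_mono_le[of "\<lambda>k. g (X k)"] step(1) by blast
  assume "j < k"
  \<comment> \<open>The covering set of iteration \<open>j\<close> is contained in
    \<open>H (Suc j)\<close>, and histories only grow.\<close>
  then have "H (Suc j) \<subseteq> H k"
    using lift_Suc_mono_le[of H "Suc j" k] step(2) by fastforce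
  then show "covering (X j) (H j) \<subseteq> H k" using step(2)[of j] by blast
qed

section \<open>Local optimality of accumulation points\<close>

lemma accumulation_point_mono_le:
  fixes g :: "'a::t2_space \<Rightarrow> real"
  assumes "accumulation_point X a" "isCont g a" "incseq (\<lambda>k. g (X k))"
  shows "g (X k) \<le> g a"
proof -
  obtain s where s: "strict_mono s" "(X \<circ> s) \<longlonglongrightarrow> a"
    using assms(1) unfolding accumulation_point_def by blast
  have "(\<lambda>i. g (X (s i))) \<longlonglongrightarrow> g a"
    using isCont_tendsto_compose[OF assms(2) s(2)] by (simp add: comp_def)
  moreover have "g (X k) \<le> g (X (s i))" if "k \<le> i" for i
    using incseqD[OF assms(3)] seq_suble[OF s(1), of i] that by (meson order_trans)
  ultimately show ?thesis
    by (intro LIMSEQ_le_const) auto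
qed

text \<open>Domination is first shown at interior points of \<open>F\<close> near \<open>a\<close>,
  because trial points close to such a point are themselves feasible; the other feasible points near
  \<open>a\<close> follow by ampleness.\<close>

lemma hybrid_run_local_solution:
  fixes N :: "'a::euclidean_space \<Rightarrow> real"
  assumes N: "is_norm N" and cov: "covering_operator N covering"
    and run: "hybrid_run g F attack covering search poll \<tau>a \<tau>c xs ra rc Hs X H"
    and g: "continuous_on UNIV g" and "closed F" and ample: "F \<subseteq> closure (interior F)"
    and acc: "accumulation_point X a"
  shows "local_solution g F a"
proof -
  note inv = hybrid_run_invariants[OF run]
  have cont: "isCont g z" for z using g by (simp add: continuous_on_eq_continuous_at)
  obtain A B where B: "0 < B" "\<And>x. N x \<le> B * norm x"
    and A: "0 < A" "\<And>x. A * norm x \<le> N x"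
    using is_norm_equivalent[OF N] by metis
  have le: "g h \<le> g a" if "h \<in> H k" "h \<in> F" for h k
  proof -
    have "g h \<le> g (X k)" using inv(1)[of k] that by (auto simp: dominates_def)
    also have "\<dots> \<le> g a"
      by (rule accumulation_point_mono_le[OF acc cont]) (simp add: incseq_def inv(3))
    finally show ?thesis .
  qed
  \<comment> \<open>The Euclidean radius \<open>1 / B\<close> puts this neighbourhood inside the
    open unit ball of \<open>N\<close> around \<open>a\<close>, where \<open>covering_dense\<close>
    applies.\<close>
  let ?U = "ball a (1 / B)"
  have U: "N (y - a) < 1" if "y \<in> ?U" for y
  proof -
    have "B * norm (y - a) < 1"
      using that B(1) by (simp add: dist_norm norm_minus_commute field_simps)
    then show ?thesis using B(2)[of "y - a"] by simp
  qed
  have closed_le: "closed {z. g z \<le> g a}"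
    by (intro closed_Collect_le g continuous_on_const)
  let ?D = "(\<Union>k. H k) \<inter> F"
  have int: "z \<in> closure ?D" if z: "z \<in> ?U" "z \<in> interior F" for z
  proof (unfold closure_approachable, intro allI impI)
    fix e :: real assume "0 < e"
    obtain d where d: "0 < d" "ball z d \<subseteq> F" using z(2) by (auto simp: mem_interior)
    \<comment> \<open>The bound \<open>d\<close> forces the trial point into \<open>F\<close>, the
      bound \<open>e\<close> makes it close to \<open>z\<close>, and \<open>A\<close> converts
      \<open>N\<close>-distance to Euclidean distance.\<close>
    have "0 < A * min d e" using A(1) d(1) \<open>0 < e\<close> by simp
    then obtain k h where h: "h \<in> H k" "N (z - h) < A * min d e"
      using covering_dense[OF N cov inv(2) inv(4) acc U[OF z(1)]] by metis
    then have "A * norm (z - h) < A * min d e" using A(2)[of "z - h"] by simp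
    then have "dist z h < min d e" using A(1) by (simp add: dist_norm)
    then show "\<exists>h\<in>?D. dist h z < e"
      using h(1) d(2) by (intro bexI[of _ h]) (auto simp: dist_commute)
  qed
  have D: "closure ?D \<subseteq> {z. g z \<le> g a}"
    using closure_minimal[OF _ closed_le, of ?D] le by blast
  \<comment> \<open>Since \<open>?U\<close> is open, a point of \<open>?U\<close> in the closure of
    \<open>interior F\<close> is a limit of interior points that also lie in
    \<open>?U\<close>.\<close>
  have "F \<inter> ?U \<subseteq> closure (?U \<inter> interior F)"
    using open_Int_closure_subset[of ?U "interior F"] ample by auto
  also have "\<dots> \<subseteq> {z. g z \<le> g a}"
    using int D by (intro closure_minimal[OF _ closed_le]) blast
  finally have "\<forall>z\<in>F \<inter> ?U. g z \<le> g a" by blast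
  moreover have "a \<in> F"
  proof -
    obtain s where "(X \<circ> s) \<longlonglongrightarrow> a" using acc unfolding accumulation_point_def by blast
    moreover have "(X \<circ> s) i \<in> F" for i using inv(1) by (auto simp: dominates_def)
    ultimately show ?thesis using closed_sequentially[OF \<open>closed F\<close>] by blast
  qed
  ultimately show ?thesis
    unfolding local_solution_def using B(1) by (intro conjI exI[of _ ?U]) auto
qed

theorem theorem1:
  fixes \<Phi> :: "real ^ 'n \<Rightarrow> real ^ 'm"
    and f :: "real ^ 'm \<Rightarrow> real"
    and c :: "real ^ 'm \<Rightarrow> real ^ 'p"
    and F :: "(real ^ 'n) set"
    and N :: "real ^ 'n \<Rightarrow> real"
    and attack :: "real ^ 'n \<Rightarrow> real \<Rightarrow> (real ^ 'n) set"
    and covering search :: "real ^ 'n \<Rightarrow> (real ^ 'n) set \<Rightarrow> (real ^ 'n) set"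
    and poll :: "real ^ 'n \<Rightarrow> real \<Rightarrow> (real ^ 'n) set \<Rightarrow> (real ^ 'n) set"
    and \<tau>_atck \<tau>_cdsm :: real
    and x x_sharp :: "nat \<Rightarrow> real ^ 'n"
    and r_atck r_cdsm :: "nat \<Rightarrow> real"
    and H H_sharp :: "nat \<Rightarrow> (real ^ 'n) set"
  defines "F \<equiv> {y. c (\<Phi> y) \<le> 0}"
  assumes "is_norm N"
    and "continuous_on UNIV \<Phi>"
    and "f differentiable_on UNIV"
    and "F \<noteq> {}" and "compact F" and "F \<subseteq> closure (interior F)"
    and "attack_operator N F attack"
    and "covering_operator N covering"
    and "search_operator search"
    and "poll_operator N poll"
    and "\<tau>_atck > 1" and "\<tau>_cdsm > 1"
    and "hybrid_run (f \<circ> \<Phi>) F attack covering search poll \<tau>_atck \<tau>_cdsm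
           x r_atck r_cdsm H x_sharp H_sharp"
  shows "(\<exists>a. accumulation_point x_sharp a) \<and>
         (\<forall>a. accumulation_point x_sharp a \<longrightarrow> local_solution (f \<circ> \<Phi>) F a)"
proof -
  have g: "continuous_on UNIV (f \<circ> \<Phi>)"
    using continuous_on_compose[OF assms(3)]
      continuous_on_subset[OF differentiable_imp_continuous_on[OF assms(4)]] by blast
  have "\<forall>k. x_sharp k \<in> F"
    using hybrid_run_invariants(1)[OF assms(14)] by (simp add: dominates_def)
  then have "\<exists>a. accumulation_point x_sharp a"
    using \<open>compact F\<close> unfolding compact_def accumulation_point_def by blast
  moreover have "local_solution (f \<circ> \<Phi>) F a" if "accumulation_point x_sharp a" for a
    using hybrid_run_local_solution[OF assms(2) assms(9) assms(14) g _ assms(7) that]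
      compact_imp_closed[OF assms(6)] by blast
  ultimately show ?thesis by blast
qed

end
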